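(* Let $\mathbf{d}=\mathbf{Z}\mathbf{k}$, $\underline{d}=\min_n|d_n|$, $q\ge1$, and $\beta=\|\mathbf{Z}\|_q\|\mathbf{p}\|_q$. The radius $R$ of the $\ell_q$-norm ball $\mathcal{C}_R=\{\mathbf{v}:\|\mathbf{v}-\mathbf{d}\|_q\le R\}$ for the contraction mapping, that is, the radius $R>0$ subject to the three conditions $$R\le\underline{d},\qquad R(\underline{d}-R)\ge\|\mathbf{Z}\|_q\|\mathbf{p}\|_q,\qquad(\underline{d}-R)^2>\|\mathbf{Z}\|_q\|\mathbf{p}\|_q,$$ is confined within $$R\in(\underline{R},\overline{R}):=\left(\frac{\underline{d}-\sqrt{\underline{d}^2-4\beta}}{2},\ \underline{d}-\sqrt{\beta}\right)$$ if $$\underline{d}^2\ge 4\beta.$$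
   Context: DC network model. A DC power system is a connected undirected graph on the finite bus set $\mathcal{N}^+=\{0,1,\dots,N\}$, which is partitioned into the constant-voltage buses $\mathcal{V}$ (with $0\in\mathcal{V}$) and the remaining buses $\mathcal{P}=\mathcal{N}^+\setminus\mathcal{V}$, with $P=|\mathcal{P}|\ge 1$. Line conductances are $g_{nm}=g_{mn}\ge 0$, with $g_{nm}>0$ iff $n,m$ are joined by a line, and $g_{nn}=0$. Fixed voltages $v_m$ are given for $m\in\mathcal{V}$. For each $n\in\mathcal{P}$ the load/generator data are: constant-current component $i_n^o\ge0$, constant-conductance component $g_n^o\ge 0$, and constant-power component $p_n^o\in\mathbb{R}$ (positive for loads, negative for generators). For $n\in\mathcal{P}$ define $$c_n=\sum_{m\in\mathcal{N}^+}g_{nm}+g_n^o,\qquad k_n=\sum_{m\in\mathcal{V}}g_{nm}v_m-i_n^o .$$ Vectors in $\mathbb{R}^P$ are indexed by $\mathcal{P}$; $\mathbf{k}=(k_n)_{n\in\mathcal{P}}$, $\mathbf{p}=(p_n^o)_{n\in\mathcal{P}}$. $\mathbf{G}$ is the symmetric positive definite $P\times P$ matrix with $G_{nn}=c_n$ and $G_{nm}=-g_{nm}$ for $n\ne m$, and $\mathbf{Z}=\mathbf{G}^{-1}$. $\|\cdot\|_q$ is the $\ell_q$ norm for vectors and the induced operator norm for matrices. The contraction mapping referred to is $\mathbf{h}(\mathbf{v})=\mathbf{Z}[\mathbf{k}-\mathbf{D}(\mathbf{v})\mathbf{p}]$, with $\mathbf{D}(\mathbf{v})$ the inverse of the diagonal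 matrix with diagonal entries $v_n$. The three conditions on $R$ are those under which the Z-bus iterations $\mathbf{v}^{t+1}=\mathbf{h}(\mathbf{v}^t)$ are shown to converge to the unique power flow solution (fixed point of $\mathbf{h}$) in $\mathcal{C}_R$: they ensure that $\mathbf{h}$ maps $\mathcal{C}_R$ into itself and is a contraction there in the $\ell_q$ norm. Each condition introduces a range for $R$, and the lemma concerns the intersection of these ranges.
   Formalization: The left endpoint of the interval is treated apart: the admissible radii other than that endpoint form exactly the open interval, and the endpoint is itself admissible exactly when 0 < β and 4β < d² (so the open interval as printed fails there). *)

theory Defs
  imports "HOL-Analysis.Analysis"
begin

section \<open>DC networks\<close>

record dc_network =
  last_bus :: nat                          \<comment> \<open>buses are \<open>{0..last_bus}\<close>\<close>
  volt_buses :: "nat set"                  \<comment> \<open>constant-voltage buses\<close>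
  conductance :: "nat \<Rightarrow> nat \<Rightarrow> real"
  volt :: "nat \<Rightarrow> real"                    \<comment> \<open>relevant on \<open>volt_buses\<close> only\<close>
  load_current :: "nat \<Rightarrow> real"            \<comment> \<open>the load data are relevant off \<open>volt_buses\<close> only\<close>
  load_conductance :: "nat \<Rightarrow> real"
  load_power :: "nat \<Rightarrow> real"

definition buses :: "dc_network \<Rightarrow> nat set" where
  "buses net = {0..last_bus net}"

definition power_buses :: "dc_network \<Rightarrow> nat set" where
  "power_buses net = buses net - volt_buses net"

definition lines :: "dc_network \<Rightarrow> (nat \<times> nat) set" where
  "lines net = {(n, m). n \<in> buses net \<and> m \<in> buses net \<and> conductance net n m > 0}"

definition valid_network :: "dc_network \<Rightarrow> bool" where
  "valid_network net \<longleftrightarrow>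
     volt_buses net \<subseteq> buses net \<and> 0 \<in> volt_buses net \<and> power_buses net \<noteq> {} \<and>
     (\<forall>n\<in>buses net. \<forall>m\<in>buses net.
        conductance net n m = conductance net m n \<and> conductance net n m \<ge> 0) \<and>
     (\<forall>n\<in>buses net. conductance net n n = 0) \<and>
     (\<forall>n\<in>buses net. \<forall>m\<in>buses net. (n, m) \<in> (lines net)\<^sup>*) \<and>
     (\<forall>n\<in>power_buses net. load_current net n \<ge> 0 \<and> load_conductance net n \<ge> 0)"

definition c_coeff :: "dc_network \<Rightarrow> nat \<Rightarrow> real" where
  "c_coeff net n = (\<Sum>m\<in>buses net. conductance net n m) + load_conductance net n"

definition k_coeff :: "dc_network \<Rightarrow> nat \<Rightarrow> real" where
  "k_coeff net n = (\<Sum>m\<in>volt_buses net. conductance net n m * volt net m) - load_current net n"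

text \<open>
  Vectors and matrices indexed by \<open>power_buses net\<close> are represented over a finite index type
  \<open>'p\<close> together with a bijection \<open>idx\<close> from \<open>'p\<close> onto \<open>power_buses net\<close>.
\<close>

definition k_vec :: "dc_network \<Rightarrow> ('p \<Rightarrow> nat) \<Rightarrow> real ^ 'p" where
  "k_vec net idx = (\<chi> i. k_coeff net (idx i))"

definition p_vec :: "dc_network \<Rightarrow> ('p \<Rightarrow> nat) \<Rightarrow> real ^ 'p" where
  "p_vec net idx = (\<chi> i. load_power net (idx i))"

definition G_mat :: "dc_network \<Rightarrow> ('p \<Rightarrow> nat) \<Rightarrow> real ^ 'p ^ 'p" where
  "G_mat net idx =
     (\<chi> i j. if i = j then c_coeff net (idx i) else - conductance net (idx i) (idx j))"

text \<open>
  For a valid network, connectedness and \<open>0 \<in> volt_buses net\<close> make \<open>G_mat\<close> positive definite,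
  so \<open>matrix_inv\<close> is its actual inverse.
\<close>

definition Z_mat :: "dc_network \<Rightarrow> ('p \<Rightarrow> nat) \<Rightarrow> real ^ 'p ^ 'p" where
  "Z_mat net idx = matrix_inv (G_mat net idx)"

section \<open>Norms\<close>

text \<open>Meaningful for \<open>1 \<le> q\<close>; the case \<open>q = \<infinity>\<close> is the maximum norm.\<close>

definition lq_norm :: "ereal \<Rightarrow> real ^ 'n \<Rightarrow> real" where
  "lq_norm q x =
     (if q = \<infinity> then Max (range (\<lambda>i. \<bar>x $ i\<bar>))
      else (\<Sum>i\<in>UNIV. \<bar>x $ i\<bar> powr real_of_ereal q) powr (1 / real_of_ereal q))"

definition lq_op_norm :: "ereal \<Rightarrow> real ^ 'n ^ 'm \<Rightarrow> real" where
  "lq_op_norm q A = (SUP x\<in>{x. x \<noteq> 0}. lq_norm q (A *v x) / lq_norm q x)"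

end

theory Submission
  imports Defs
begin

text \<open>
  Once \<open>\<beta> \<ge> 0\<close> is known, the claim is elementary. The condition \<open>R (d - R) \<ge> \<beta>\<close> places \<open>R\<close> between
  the two roots \<open>(d \<plusminus> sqrt (d\<^sup>2 - 4 \<beta>)) / 2\<close>, and the other two conditions mean
  \<open>R < d - sqrt \<beta>\<close>, a bound that never exceeds the larger root. For \<open>\<beta> \<ge> 0\<close> one needs that
  the supremum defining the operator norm ranges over a bounded set, which holds because
  the \<open>\<ell>\<^sub>q\<close> norm is equivalent to the maximum norm.
\<close>

lemma lq_norm_nonneg: "0 \<le> lq_norm q x"
proof -
  have "0 \<le> Max (range (\<lambda>i. \<bar>x $ i\<bar>))"
    by (simp add: Max_ge_iff)
  then show ?thesis
    by (simp add: lq_norm_def)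
qed

text \<open>With \<open>lq_norm_le_of_component_le\<close>, this gives the two-sided comparison with
  the maximum norm.\<close>

lemma component_le_lq_norm:
  assumes "1 \<le> q"
  shows "\<bar>x $ i\<bar> \<le> lq_norm q x"
proof (cases "q = \<infinity>")
  case True
  then show ?thesis by (simp add: lq_norm_def)
next
  case False
  define r where "r = real_of_ereal q"
  have r: "1 \<le> r"
    using assms False unfolding r_def by (cases q) auto
  have "\<bar>x $ i\<bar> = (\<bar>x $ i\<bar> powr r) powr (1 / r)"
    using r by (simp add: powr_powr)
  also have "\<dots> \<le> (\<Sum>i\<in>UNIV. \<bar>x $ i\<bar> powr r) powr (1 / r)"
    using r by (intro powr_mono2 member_le_sum) auto
  finally show ?thesis
    using False by (simp add: lq_norm_def r_def)
qed

lemma lq_norm_le_of_component_le: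
  fixes x :: "real ^ 'n"
  assumes "1 \<le> q" and "\<And>i. \<bar>x $ i\<bar> \<le> M"
  shows "lq_norm q x \<le> real CARD('n) * M"
proof -
  have M: "0 \<le> M"
    using assms(2) abs_ge_zero order_trans by blast
  have n: "1 \<le> real CARD('n)"
    by (simp add: Suc_leI)
  show ?thesis
  proof (cases "q = \<infinity>")
    case True
    have "Max (range (\<lambda>i. \<bar>x $ i\<bar>)) \<le> M"
      using assms(2) by auto
    also have "\<dots> \<le> real CARD('n) * M"
      using n M by (simp add: mult_le_cancel_right1)
    finally show ?thesis
      using True by (simp add: lq_norm_def)
  next
    case False
    define r where "r = real_of_ereal q"
    have r: "1 \<le> r"
      using assms(1) False unfolding r_def by (cases q) auto
    have "(\<Sum>i\<in>UNIV. \<bar>x $ i\<bar> powr r) \<le> (\<Sum>i\<in>(UNIV::'n set). M powr r)"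
      using r assms(2) by (intro sum_mono powr_mono2) auto
    then have "lq_norm q x \<le> (real CARD('n) * M powr r) powr (1 / r)"
      using False r by (auto simp: lq_norm_def r_def intro!: powr_mono2 sum_nonneg)
    also have "\<dots> = real CARD('n) powr (1 / r) * M"
      using r M by (simp add: powr_mult powr_powr)
    \<comment> \<open>Since \<open>1 / r \<le> 1\<close> and the base is at least 1, the factor can
      be made independent of \<open>q\<close>.\<close>
    also have "\<dots> \<le> real CARD('n) powr 1 * M"
      using r n M by (intro mult_right_mono powr_mono) auto
    finally show ?thesis by simp
  qed
qed

lemma bdd_above_lq_ratios:
  fixes A :: "real ^ 'n ^ 'm"
  assumes "1 \<le> q"
  shows "bdd_above ((\<lambda>x. lq_norm q (A *v x) / lq_norm q x) ` {x. x \<noteq> 0})"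
proof (rule bdd_aboveI2)
  fix x :: "real ^ 'n"
  \<comment> \<open>A bound uniform in \<open>i\<close>: the sum over all entries dominates every
    row sum.\<close>
  define K where "K = (\<Sum>i\<in>UNIV. \<Sum>j\<in>UNIV. \<bar>A $ i $ j\<bar>)"
  have "\<bar>(A *v x) $ i\<bar> \<le> K * lq_norm q x" for i
  proof -
    have "\<bar>(A *v x) $ i\<bar> \<le> (\<Sum>j\<in>UNIV. \<bar>A $ i $ j\<bar> * \<bar>x $ j\<bar>)"
      unfolding matrix_vector_mult_def by (simp flip: abs_mult)
    also have "\<dots> \<le> (\<Sum>j\<in>UNIV. \<bar>A $ i $ j\<bar> * lq_norm q x)"
      by (intro sum_mono mult_left_mono component_le_lq_norm assms) auto
    also have "\<dots> = (\<Sum>j\<in>UNIV. \<bar>A $ i $ j\<bar>) * lq_norm q x"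
      by (simp add: sum_distrib_right)
    also have "\<dots> \<le> K * lq_norm q x"
      unfolding K_def
      by (intro mult_right_mono lq_norm_nonneg
          member_le_sum[where f = "\<lambda>i. \<Sum>j\<in>UNIV. \<bar>A $ i $ j\<bar>"] sum_nonneg) auto
    finally show ?thesis .
  qed
  then have "lq_norm q (A *v x) \<le> real CARD('m) * K * lq_norm q x"
    using lq_norm_le_of_component_le[OF assms, of "A *v x"] by (simp add: mult.assoc)
  moreover have "0 \<le> K"
    unfolding K_def by (intro sum_nonneg) auto
  \<comment> \<open>If the denominator vanishes, the quotient is 0 by convention and
    \<open>0 \<le> K\<close> suffices.\<close>
  ultimately show "lq_norm q (A *v x) / lq_norm q x \<le> real CARD('m) * K"
    using lq_norm_nonneg[of q x] by (cases "lq_norm q x = 0") (auto simp: divide_le_eq)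
qed

text \<open>A real \<open>SUP\<close> dominates the members of its set only once the set is bounded
  above; the all-ones vector then supplies a nonnegative ratio.\<close>

lemma lq_op_norm_nonneg:
  fixes A :: "real ^ 'n ^ 'm"
  assumes "1 \<le> q"
  shows "0 \<le> lq_op_norm q A"
  unfolding lq_op_norm_def
  by (rule cSUP_upper2[OF bdd_above_lq_ratios[OF assms], where x = 1])
    (auto simp: lq_norm_nonneg)

lemma radius_conditions_iff:
  fixes d \<beta> R :: real
  assumes "0 \<le> \<beta>" and "0 \<le> d" and "4 * \<beta> \<le> d\<^sup>2"
  shows "R \<le> d \<and> \<beta> \<le> R * (d - R) \<and> \<beta> < (d - R)\<^sup>2 \<longleftrightarrow>
    (d - sqrt (d\<^sup>2 - 4 * \<beta>)) / 2 \<le> R \<and> R < d - sqrt \<beta>"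
proof -
  define s where "s = sqrt (d\<^sup>2 - 4 * \<beta>)"
  define b where "b = sqrt \<beta>"
  have s: "0 \<le> s" "s\<^sup>2 = d\<^sup>2 - 4 * b\<^sup>2" and b: "0 \<le> b" "\<beta> = b\<^sup>2"
    using assms unfolding s_def b_def by auto
  have "(2 * b)\<^sup>2 \<le> d\<^sup>2"
    using assms(3) b by (simp add: power_mult_distrib)
  then have db: "2 * b \<le> d"
    using assms(2) by (rule power2_le_imp_le)
  \<comment> \<open>Four times this product is \<open>s\<^sup>2 - (d - 2 * b)\<^sup>2\<close>, and
    \<open>d - 2 * b \<le> s\<close> rearranges to \<open>root\<close>.\<close>
  have "0 \<le> b * (d - 2 * b)"
    using b db by simp
  then have "(d - 2 * b)\<^sup>2 \<le> s\<^sup>2"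
    using s(2) by (simp add: power2_eq_square algebra_simps)
  then have root: "d - b \<le> (d + s) / 2"
    using power2_le_imp_le[OF _ s(1)] by fastforce
  \<comment> \<open>Completing the square: \<open>s\<^sup>2 - (d - 2 * R)\<^sup>2 = 4 * (R * (d - R)
    - b\<^sup>2)\<close>.\<close>
  have "b\<^sup>2 \<le> R * (d - R) \<longleftrightarrow> (d - 2 * R)\<^sup>2 \<le> s\<^sup>2"
    unfolding s(2) by (simp add: power2_eq_square algebra_simps) linarith
  also have "\<dots> \<longleftrightarrow> \<bar>d - 2 * R\<bar> \<le> s"
    using s(1) by (simp flip: abs_le_square_iff)
  finally have 1: "b\<^sup>2 \<le> R * (d - R) \<longleftrightarrow> (d - s) / 2 \<le> R \<and> R \<le> (d + s) / 2"
    by (auto simp: abs_le_iff)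
  \<comment> \<open>\<open>R \<le> d\<close> selects the nonnegative branch of the square.\<close>
  have "R \<le> d \<and> b\<^sup>2 < (d - R)\<^sup>2 \<longleftrightarrow> R < d - b"
    using b(1) power2_less_imp_less[of b "d - R"] power_strict_mono[of b "d - R" 2] by auto
  with 1 root have "R \<le> d \<and> b\<^sup>2 \<le> R * (d - R) \<and> b\<^sup>2 < (d - R)\<^sup>2 \<longleftrightarrow> (d - s) / 2 \<le> R \<and> R < d - b"
    by auto
  then show ?thesis
    by (simp only: b(2)[symmetric] s_def[symmetric] b_def[symmetric])
qed

text \<open>These facts settle how the smaller root interacts with the constraint
  \<open>0 < R\<close> and when the interval is nonempty.\<close>

lemma smaller_root_bounds:
  fixes d \<beta> :: real
  assumes "0 \<le> \<beta>" and "0 \<le> d" and "4 * \<beta> \<le> d\<^sup>2"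
  shows "0 \<le> (d - sqrt (d\<^sup>2 - 4 * \<beta>)) / 2"
    and "0 < (d - sqrt (d\<^sup>2 - 4 * \<beta>)) / 2 \<longleftrightarrow> 0 < \<beta>"
    and "(d - sqrt (d\<^sup>2 - 4 * \<beta>)) / 2 < d - sqrt \<beta> \<longleftrightarrow> 4 * \<beta> < d\<^sup>2"
proof -
  have "sqrt (d\<^sup>2 - 4 * \<beta>) \<le> sqrt (d\<^sup>2)"
    using assms(1) by (intro real_sqrt_le_mono) simp
  then show "0 \<le> (d - sqrt (d\<^sup>2 - 4 * \<beta>)) / 2"
    using assms(2) by simp
  have "sqrt (d\<^sup>2 - 4 * \<beta>) < sqrt (d\<^sup>2) \<longleftrightarrow> 0 < \<beta>"
    unfolding real_sqrt_less_iff by simp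
  then show "0 < (d - sqrt (d\<^sup>2 - 4 * \<beta>)) / 2 \<longleftrightarrow> 0 < \<beta>"
    using assms(2) by simp
  have two: "sqrt (4 * \<beta>) = 2 * sqrt \<beta>"
    by (simp add: real_sqrt_mult)
  show "(d - sqrt (d\<^sup>2 - 4 * \<beta>)) / 2 < d - sqrt \<beta> \<longleftrightarrow> 4 * \<beta> < d\<^sup>2"
  \<comment> \<open>In the case of equality both sides are \<open>d / 2\<close>; otherwise the root
    is at most \<open>d / 2\<close>, which lies strictly below
    \<open>d - sqrt \<beta>\<close>.\<close>
  proof (cases "4 * \<beta> = d\<^sup>2")
    case True
    then have "d = 2 * sqrt \<beta>"
      using two assms(2) by simp
    with True show ?thesis by simp
  next
    case False
    with assms(3) have lt: "4 * \<beta> < d\<^sup>2" by simp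
    then have "sqrt (4 * \<beta>) < sqrt (d\<^sup>2)" by (rule real_sqrt_less_mono)
    then have "2 * sqrt \<beta> < d"
      using two assms(2) by simp
    moreover have "0 \<le> sqrt (d\<^sup>2 - 4 * \<beta>)"
      using lt by simp
    ultimately have "(d - sqrt (d\<^sup>2 - 4 * \<beta>)) / 2 < d - sqrt \<beta>" by argo
    with lt show ?thesis by simp
  qed
qed

text \<open>At \<open>R_low\<close> the product condition holds with equality, so the open interval
  is exact only up to this endpoint, which is treated separately. It fails to be a radius when
  \<open>\<beta> = 0\<close>, where it is 0, or when \<open>4 * \<beta> = d_min\<^sup>2\<close>,
  where it equals \<open>R_high\<close>.\<close>

theorem lemma2:
  fixes net :: dc_network and idx :: "'p::finite \<Rightarrow> nat" and q :: ereal
    and d :: "real ^ 'p" and d_min \<beta> R_low R_high :: real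
  assumes "valid_network net"
    and "bij_betw idx UNIV (power_buses net)"
    and "1 \<le> q"
  defines "d \<equiv> Z_mat net idx *v k_vec net idx"
    and "d_min \<equiv> Min (range (\<lambda>i. \<bar>d $ i\<bar>))"
    and "\<beta> \<equiv> lq_op_norm q (Z_mat net idx) * lq_norm q (p_vec net idx)"
    and "R_low \<equiv> (d_min - sqrt (d_min\<^sup>2 - 4 * \<beta>)) / 2"
    and "R_high \<equiv> d_min - sqrt \<beta>"
  defines "radii \<equiv> {R. 0 < R \<and> R \<le> d_min \<and>
      R * (d_min - R) \<ge> lq_op_norm q (Z_mat net idx) * lq_norm q (p_vec net idx) \<and>
      (d_min - R)\<^sup>2 > lq_op_norm q (Z_mat net idx) * lq_norm q (p_vec net idx)}"
  assumes "d_min\<^sup>2 \<ge> 4 * \<beta>"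
  shows "radii - {R_low} = {R_low <..< R_high} \<and>
         (R_low \<in> radii \<longleftrightarrow> 0 < \<beta> \<and> 4 * \<beta> < d_min\<^sup>2)"
proof -
  have \<beta>: "0 \<le> \<beta>"
    unfolding \<beta>_def using \<open>1 \<le> q\<close> by (intro mult_nonneg_nonneg lq_op_norm_nonneg lq_norm_nonneg)
  have d_min: "0 \<le> d_min"
    unfolding d_min_def by simp
  note bounds = smaller_root_bounds[OF \<beta> d_min \<open>d_min\<^sup>2 \<ge> 4 * \<beta>\<close>, folded R_low_def R_high_def]
  have "radii = {R. 0 < R \<and> R_low \<le> R \<and> R < R_high}"
    using radius_conditions_iff[OF \<beta> d_min \<open>d_min\<^sup>2 \<ge> 4 * \<beta>\<close>]
    unfolding radii_def R_low_def R_high_def \<beta>_def[symmetric] by blast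
  \<comment> \<open>Inside the interval \<open>0 < R\<close> follows from
    \<open>0 \<le> R_low\<close>; at \<open>R_low\<close> the two equivalences in
    \<open>bounds\<close> decide.\<close>
  then show ?thesis
    using bounds by auto
qed

end
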